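(* Let $K$ be a field of characteristic zero and let $L_n$ be the free metabelian Leibniz algebra over $K$ on $x_1,\ldots,x_n$. Put $a_i=[x_i,x_i]$ for $1\le i\le n$, and let $p=\sum_{i=1}^n a_i p_i\in L_n'$ with $p_i\in K[R_n]=K[r_1,\ldots,r_n]$, $1\le i\le n$. Then $p$ is symmetric if and only if the following conditions all hold: (i) $p_1(r_1,r_2,\ldots,r_n)=\pi p_1(r_1,r_2,\ldots,r_n)=p_1(r_1,r_{\pi(2)},\ldots,r_{\pi(n)})$ for all $\pi\in\Pi_1$; (ii) for every $i=2,\ldots,n$, $\sigma p_i=p_i$ for all $\sigma\in\Pi_i$; (iii) for every $i=2,\ldots,n$, $p_i=(1i)p_1=p_1(r_i,r_2,\ldots,r_{i-1},r_1,r_{i+1},\ldots,r_n)$, where $(1i)\in S_n$ is the transposition.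
   Context: A Leibniz algebra over $K$ is a $K$-vector space with a bilinear bracket $[\cdot,\cdot]$ satisfying $[[x,y],z]=[[x,z],y]+[x,[y,z]]$ for all $x,y,z$. $L_n$ is the free algebra with free generators $X_n=\{x_1,\ldots,x_n\}$ in the variety of Leibniz algebras over $K$ satisfying the metabelian identity $[[x,y],[z,t]]=0$. $L_n'=[L_n,L_n]$ is its commutator ideal. $K[R_n]=K[r_1,\ldots,r_n]$ is the commutative polynomial algebra in $r_1,\ldots,r_n$, and $L_n'$ is a right $K[R_n]$-module via $u\,r_i=[u,x_i]$ for $u\in L_n'$ (these operators commute on $L_n'$ by the Leibniz and metabelian identities). The symmetric group $S_n$ acts on $L_n$ by algebra automorphisms with $\sigma x_i=x_{\sigma(i)}$, and on $K[R_n]$ by $\sigma f(r_1,\ldots,r_n)=f(r_{\sigma(1)},\ldots,r_{\sigma(n)})$. An element $s\in L_n$ is called symmetric if $\sigma s=s$ for all $\sigma\in S_n$. For $1\le i\le n$, $\Pi_i=\{\pi\in S_n\mid \pi(i)=i\}$. *)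

theory Defs
  imports Complex_Main "HOL-Library.Poly_Mapping" "HOL-Combinatorics.Permutations"
begin

section \<open>Leibniz algebras\<close>

locale leibniz_algebra = vector_space scale
  for scale :: "'k::field \<Rightarrow> 'a::ab_group_add \<Rightarrow> 'a" +
  fixes bracket :: "'a \<Rightarrow> 'a \<Rightarrow> 'a"
  assumes bracket_add_left: "bracket (x + y) z = bracket x z + bracket y z"
    and bracket_add_right: "bracket x (y + z) = bracket x y + bracket x z"
    and bracket_scale_left: "bracket (scale c x) y = scale c (bracket x y)"
    and bracket_scale_right: "bracket x (scale c y) = scale c (bracket x y)"
    and leibniz: "bracket (bracket x y) z = bracket (bracket x z) y + bracket x (bracket y z)"

locale metabelian_leibniz_algebra = leibniz_algebra +
  assumes metabelian: "bracket (bracket x y) (bracket z t) = 0"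


section \<open>The free nonassociative algebra\<close>

text \<open>The generators are indexed by the type \<open>'n\<close>; for finite \<open>'n\<close> this is the index set
  \<open>{1, \<dots>, n}\<close> with \<open>n = CARD('n)\<close>, and \<open>S\<^sub>n\<close> consists of the permutations of \<open>UNIV :: 'n set\<close>.
  Finitely supported functions on the free magma form the free nonassociative algebra.\<close>

datatype 'n nmon = Gen 'n | Br "'n nmon" "'n nmon"

lift_definition na_scale :: "'k::field \<Rightarrow> ('n nmon \<Rightarrow>\<^sub>0 'k) \<Rightarrow> ('n nmon \<Rightarrow>\<^sub>0 'k)"
  is "\<lambda>c f m. c * f m"
  by (erule finite_subset[rotated]) auto

text \<open>Bilinear extension of \<open>Br\<close>.\<close>

lift_definition na_bracket ::
    "('n nmon \<Rightarrow>\<^sub>0 'k::field) \<Rightarrow> ('n nmon \<Rightarrow>\<^sub>0 'k) \<Rightarrow> ('n nmon \<Rightarrow>\<^sub>0 'k)"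
  is "\<lambda>f g m. case m of Gen i \<Rightarrow> 0 | Br a b \<Rightarrow> f a * g b"
proof -
  fix f g :: "'n nmon \<Rightarrow> 'k"
  assume "finite {m. f m \<noteq> 0}" "finite {m. g m \<noteq> 0}"
  then have "finite ((\<lambda>(a, b). Br a b) ` ({m. f m \<noteq> 0} \<times> {m. g m \<noteq> 0}))" by simp
  moreover have "{m. (case m of Gen i \<Rightarrow> 0 | Br a b \<Rightarrow> f a * g b) \<noteq> 0}
      \<subseteq> (\<lambda>(a, b). Br a b) ` ({m. f m \<noteq> 0} \<times> {m. g m \<noteq> 0})"
    by (auto split: nmon.splits simp: image_iff) (metis nmon.exhaust)
  ultimately show "finite {m. (case m of Gen i \<Rightarrow> 0 | Br a b \<Rightarrow> f a * g b) \<noteq> 0}"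
    by (rule finite_subset[rotated])
qed

lemma lookup_na_bracket_simps [simp]:
  "Poly_Mapping.lookup (na_bracket f g) (Gen i) = 0"
  "Poly_Mapping.lookup (na_bracket f g) (Br a b) = Poly_Mapping.lookup f a * Poly_Mapping.lookup g b"
  by (simp_all add: na_bracket.rep_eq)

lemma nmon_poly_eqI:
  assumes "\<And>i. Poly_Mapping.lookup f (Gen i) = Poly_Mapping.lookup g (Gen i)"
    and "\<And>a b. Poly_Mapping.lookup f (Br a b) = Poly_Mapping.lookup g (Br a b)"
  shows "f = g"
proof (rule poly_mapping_eqI)
  fix m show "Poly_Mapping.lookup f m = Poly_Mapping.lookup g m" using assms by (cases m) auto
qed

lemma na_bracket_bilinear:
  "na_bracket (f + g) h = na_bracket f h + na_bracket g h"
  "na_bracket h (f + g) = na_bracket h f + na_bracket h g"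
  "na_bracket (na_scale c f) h = na_scale c (na_bracket f h)"
  "na_bracket h (na_scale c f) = na_scale c (na_bracket h f)"
  "na_bracket (f - g) h = na_bracket f h - na_bracket g h"
  "na_bracket h (f - g) = na_bracket h f - na_bracket h g"
  by (rule nmon_poly_eqI;
      simp add: lookup_add lookup_minus na_scale.rep_eq algebra_simps)+

lemma na_scale_linear:
  "na_scale c (f + g) = na_scale c f + na_scale c g"
  "na_scale c (f - g) = na_scale c f - na_scale c g"
  "na_scale (c + d) f = na_scale c f + na_scale d f"
  "na_scale c (na_scale d f) = na_scale (c * d) f"
  "na_scale 1 f = f"
  "na_scale (-1) f = - f"
  by (rule poly_mapping_eqI;
      simp add: lookup_add lookup_minus na_scale.rep_eq algebra_simps)+

lemma na_bracket_single:
  "na_bracket (Poly_Mapping.single a c) (Poly_Mapping.single b d)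
    = Poly_Mapping.single (Br a b) (c * d)"
  by (rule nmon_poly_eqI) (auto simp: lookup_single when_def)

lemma na_scale_single:
  "na_scale c (Poly_Mapping.single a d) = Poly_Mapping.single a (c * d)"
  by (rule poly_mapping_eqI) (auto simp: lookup_single na_scale.rep_eq when_def)

lemma na_induct [case_names zero gen br scale add]:
  fixes f :: "'n nmon \<Rightarrow>\<^sub>0 'k::field"
  assumes "P 0"
    and gen: "\<And>i. P (Poly_Mapping.single (Gen i) 1)"
    and br: "\<And>f g. P f \<Longrightarrow> P g \<Longrightarrow> P (na_bracket f g)"
    and sc: "\<And>c f. P f \<Longrightarrow> P (na_scale c f)"
    and add: "\<And>f g. P f \<Longrightarrow> P g \<Longrightarrow> P (f + g)"
  shows "P f"
proof (induction f rule: update_induct)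
  case const
  then show ?case using assms(1) by simp
next
  case (update f m c)
  have mon: "P (Poly_Mapping.single m 1)"
  proof (induction m)
    case (Gen i)
    then show ?case by (rule gen)
  next
    case (Br a b)
    then show ?case using br[OF Br] by (simp add: na_bracket_single)
  qed
  have "Poly_Mapping.update m c f = na_scale c (Poly_Mapping.single m 1) + f"
    using update(1)
    by (intro poly_mapping_eqI)
      (auto simp: lookup_update lookup_add lookup_single na_scale.rep_eq when_def in_keys_iff)
  then show ?case using add[OF sc[OF mon, of c] update(3)] by simp
qed


section \<open>The free metabelian Leibniz algebra\<close>

text \<open>The two-sided ideal generated by all consequences of the Leibniz and metabelian
  identities.\<close>

inductive_set identity_ideal :: "('n nmon \<Rightarrow>\<^sub>0 'k::field) set" where
  zero: "0 \<in> identity_ideal"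
| add: "f \<in> identity_ideal \<Longrightarrow> g \<in> identity_ideal \<Longrightarrow> f + g \<in> identity_ideal"
| scale: "f \<in> identity_ideal \<Longrightarrow> na_scale c f \<in> identity_ideal"
| left: "f \<in> identity_ideal \<Longrightarrow> na_bracket g f \<in> identity_ideal"
| right: "f \<in> identity_ideal \<Longrightarrow> na_bracket f g \<in> identity_ideal"
| leibniz: "na_bracket (na_bracket f g) h
    - (na_bracket (na_bracket f h) g + na_bracket f (na_bracket g h)) \<in> identity_ideal"
| metabelian: "na_bracket (na_bracket f g) (na_bracket h k) \<in> identity_ideal"

definition identity_rel :: "('n nmon \<Rightarrow>\<^sub>0 'k::field) \<Rightarrow> ('n nmon \<Rightarrow>\<^sub>0 'k) \<Rightarrow> bool" where
  "identity_rel f g \<longleftrightarrow> f - g \<in> identity_ideal"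

lemma identity_ideal_uminus: "f \<in> identity_ideal \<Longrightarrow> - f \<in> identity_ideal"
  using identity_ideal.scale[of f "-1"] by (simp add: na_scale_linear)

lemma identity_ideal_diff:
  "f \<in> identity_ideal \<Longrightarrow> g \<in> identity_ideal \<Longrightarrow> f - g \<in> identity_ideal"
  using identity_ideal.add[of f "- g"] identity_ideal_uminus[of g] by simp

quotient_type (overloaded) ('n, 'k) free_ml = "'n nmon \<Rightarrow>\<^sub>0 ('k::field)" / identity_rel
  morphisms rep_ml abs_ml
proof (rule equivpI)
  show "reflp identity_rel"
    by (auto simp: reflp_def identity_rel_def identity_ideal.zero)
  show "symp identity_rel"
    using identity_ideal_uminus by (fastforce simp: symp_def identity_rel_def)
  show "transp identity_rel"
    using identity_ideal.add by (fastforce simp: transp_def identity_rel_def)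
qed

instantiation free_ml :: (type, field) ab_group_add
begin

lift_definition zero_free_ml :: "('a, 'b) free_ml" is 0 .

lift_definition plus_free_ml :: "('a, 'b) free_ml \<Rightarrow> ('a, 'b) free_ml \<Rightarrow> ('a, 'b) free_ml"
  is "(+)"
  unfolding identity_rel_def by (metis add_diff_add identity_ideal.add)

lift_definition minus_free_ml :: "('a, 'b) free_ml \<Rightarrow> ('a, 'b) free_ml \<Rightarrow> ('a, 'b) free_ml"
  is "(-)"
  unfolding identity_rel_def
  by (metis (no_types, opaque_lifting) diff_add_eq diff_diff_eq2 diff_diff_add
      identity_ideal_diff add.commute)

lift_definition uminus_free_ml :: "('a, 'b) free_ml \<Rightarrow> ('a, 'b) free_ml" is uminus
  unfolding identity_rel_def using identity_ideal_uminus by fastforce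

instance
  by standard (transfer; simp add: identity_rel_def identity_ideal.zero algebra_simps)+

end

lift_definition ml_scale :: "'k \<Rightarrow> ('n, 'k::field) free_ml \<Rightarrow> ('n, 'k) free_ml" is na_scale
  unfolding identity_rel_def by (metis na_scale_linear(2) identity_ideal.scale)

lift_definition ml_bracket ::
    "('n, 'k::field) free_ml \<Rightarrow> ('n, 'k) free_ml \<Rightarrow> ('n, 'k) free_ml" is na_bracket
proof -
  fix f f' g g' :: "'n nmon \<Rightarrow>\<^sub>0 'k"
  assume "identity_rel f f'" "identity_rel g g'"
  then have "na_bracket (f - f') g + na_bracket f' (g - g') \<in> identity_ideal"
    by (auto simp: identity_rel_def intro: identity_ideal.intros)
  then show "identity_rel (na_bracket f g) (na_bracket f' g')"
    by (simp add: identity_rel_def na_bracket_bilinear)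
qed

lift_definition ml_gen :: "'n \<Rightarrow> ('n, 'k::field) free_ml"
  is "\<lambda>i. Poly_Mapping.single (Gen i) 1" .

interpretation ml: metabelian_leibniz_algebra ml_scale ml_bracket
  by unfold_locales
    (transfer; simp add: identity_rel_def identity_ideal.zero na_scale_linear na_bracket_bilinear
      identity_ideal.leibniz identity_ideal.metabelian)+

lemma ml_induct [case_names gen br scale add]:
  fixes u :: "('n, 'k::field) free_ml"
  assumes gen: "\<And>i. P (ml_gen i)"
    and br: "\<And>u v. P u \<Longrightarrow> P v \<Longrightarrow> P (ml_bracket u v)"
    and sc: "\<And>c u. P u \<Longrightarrow> P (ml_scale c u)"
    and add: "\<And>u v. P u \<Longrightarrow> P v \<Longrightarrow> P (u + v)"
  shows "P u"
proof -
  have z: "P 0" using sc[OF gen[of undefined], of 0] by simp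
  have "P (abs_ml f)" for f
  proof (induction f rule: na_induct)
    case zero
    then show ?case using z by (simp add: zero_free_ml.abs_eq)
  next
    case (gen i)
    then show ?case using assms(1)[of i] by (simp add: ml_gen.abs_eq)
  next
    case (br f g)
    then show ?case using assms(2)[OF br] by (simp add: ml_bracket.abs_eq)
  next
    case (scale c f)
    then show ?case using assms(3)[OF scale, of c] by (simp add: ml_scale.abs_eq)
  next
    case (add f g)
    then show ?case using assms(4)[OF add] by (simp add: plus_free_ml.abs_eq)
  qed
  then show ?thesis by (metis Quotient_abs_rep[OF Quotient_free_ml])
qed

context metabelian_leibniz_algebra
begin

primrec nmon_eval :: "('n \<Rightarrow> 'b) \<Rightarrow> 'n nmon \<Rightarrow> 'b" where
  "nmon_eval g (Gen i) = g i"
| "nmon_eval g (Br a b) = bracket (nmon_eval g a) (nmon_eval g b)"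

definition na_eval :: "('n \<Rightarrow> 'b) \<Rightarrow> ('n nmon \<Rightarrow>\<^sub>0 'a) \<Rightarrow> 'b" where
  "na_eval g f = (\<Sum>m\<in>Poly_Mapping.keys f. scale (Poly_Mapping.lookup f m) (nmon_eval g m))"

lemma bracket_zero [simp]: "bracket 0 x = 0" "bracket x 0 = 0"
  using bracket_add_left[of 0 0 x] bracket_add_right[of x 0 0] by auto

lemma bracket_sum_left: "bracket (sum f A) x = (\<Sum>i\<in>A. bracket (f i) x)"
  by (induction A rule: infinite_finite_induct) (auto simp: bracket_add_left)

lemma bracket_sum_right: "bracket x (sum f A) = (\<Sum>i\<in>A. bracket x (f i))"
  by (induction A rule: infinite_finite_induct) (auto simp: bracket_add_right)

lemma na_eval_superset:
  assumes "finite A" "Poly_Mapping.keys f \<subseteq> A"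
  shows "na_eval g f = (\<Sum>m\<in>A. scale (Poly_Mapping.lookup f m) (nmon_eval g m))"
  unfolding na_eval_def using assms
  by (intro sum.mono_neutral_left) (auto simp: in_keys_iff)

lemma na_eval_zero [simp]: "na_eval g 0 = 0"
  by (simp add: na_eval_def)

lemma na_eval_add: "na_eval g (f + h) = na_eval g f + na_eval g h"
proof -
  let ?A = "Poly_Mapping.keys f \<union> Poly_Mapping.keys h \<union> Poly_Mapping.keys (f + h)"
  show ?thesis
    by (simp add: na_eval_superset[of ?A] lookup_add scale_left_distrib sum.distrib subset_iff)
qed

lemma na_eval_scale: "na_eval g (na_scale c f) = scale c (na_eval g f)"
proof -
  let ?A = "Poly_Mapping.keys f \<union> Poly_Mapping.keys (na_scale c f)"
  show ?thesis
    by (simp add: na_eval_superset[of ?A] na_scale.rep_eq scale_sum_right subset_iff)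
qed

lemma na_eval_diff: "na_eval g (f - h) = na_eval g f - na_eval g h"
  using na_eval_add[of g "f - h" h] by simp

lemma na_eval_single: "na_eval g (Poly_Mapping.single m c) = scale c (nmon_eval g m)"
  by (simp add: na_eval_superset[of "{m}"])

lemma na_eval_bracket: "na_eval g (na_bracket f h) = bracket (na_eval g f) (na_eval g h)"
proof -
  let ?B = "(\<lambda>(a, b). Br a b) ` (Poly_Mapping.keys f \<times> Poly_Mapping.keys h)"
  have sub: "Poly_Mapping.keys (na_bracket f h) \<subseteq> ?B"
  proof
    fix m assume "m \<in> Poly_Mapping.keys (na_bracket f h)"
    then show "m \<in> ?B" by (cases m) (auto simp: in_keys_iff)
  qed
  have inj: "inj_on (\<lambda>(a, b). Br a b) (Poly_Mapping.keys f \<times> Poly_Mapping.keys h)" by (auto simp: inj_on_def)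
  have "na_eval g (na_bracket f h)
      = (\<Sum>m\<in>?B. scale (Poly_Mapping.lookup (na_bracket f h) m) (nmon_eval g m))"
    by (rule na_eval_superset) (use sub in auto)
  also have "\<dots> = (\<Sum>(a, b)\<in>Poly_Mapping.keys f \<times> Poly_Mapping.keys h.
      scale (Poly_Mapping.lookup f a * Poly_Mapping.lookup h b) (bracket (nmon_eval g a) (nmon_eval g b)))"
    by (subst sum.reindex[OF inj]) (auto intro!: sum.cong)
  also have "\<dots> = bracket (na_eval g f) (na_eval g h)"
    unfolding na_eval_def bracket_sum_left unfolding bracket_sum_right
    by (simp add: bracket_scale_left bracket_scale_right sum.cartesian_product[symmetric]
        mult.commute)
  finally show ?thesis .
qed

lemma na_eval_ideal: "f \<in> identity_ideal \<Longrightarrow> na_eval g f = 0"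
proof (induction f rule: identity_ideal.induct)
  case (leibniz f h k)
  then show ?case
    using leibniz_algebra.leibniz[OF leibniz_algebra_axioms, of "na_eval g f" "na_eval g h" "na_eval g k"]
    by (simp add: na_eval_add na_eval_diff na_eval_bracket)
qed (auto simp: na_eval_add na_eval_diff na_eval_bracket na_eval_scale metabelian)

lift_definition ml_hom :: "('n \<Rightarrow> 'b) \<Rightarrow> ('n, 'a) free_ml \<Rightarrow> 'b" is na_eval
  using na_eval_ideal by (fastforce simp: identity_rel_def na_eval_diff)

lemma ml_hom_simps:
  "ml_hom g 0 = 0"
  "ml_hom g (ml_gen i) = g i"
  "ml_hom g (u + v) = ml_hom g u + ml_hom g v"
  "ml_hom g (ml_scale c u) = scale c (ml_hom g u)"
  "ml_hom g (ml_bracket u v) = bracket (ml_hom g u) (ml_hom g v)"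
  by (transfer; simp add: na_eval_add na_eval_scale na_eval_bracket na_eval_single)+

theorem ml_universal:
  fixes g :: "'n \<Rightarrow> 'b"
  shows "\<exists>!h :: ('n, 'a) free_ml \<Rightarrow> 'b.
    (\<forall>u v. h (u + v) = h u + h v) \<and> (\<forall>c u. h (ml_scale c u) = scale c (h u)) \<and>
    (\<forall>u v. h (ml_bracket u v) = bracket (h u) (h v)) \<and> (\<forall>i. h (ml_gen i) = g i)"
proof (rule ex1I[of _ "ml_hom g"])
  fix h :: "('n, 'a) free_ml \<Rightarrow> 'b"
  assume h: "(\<forall>u v. h (u + v) = h u + h v) \<and> (\<forall>c u. h (ml_scale c u) = scale c (h u)) \<and>
    (\<forall>u v. h (ml_bracket u v) = bracket (h u) (h v)) \<and> (\<forall>i. h (ml_gen i) = g i)"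
  show "h = ml_hom g"
  proof
    fix u show "h u = ml_hom g u"
      by (induction u rule: ml_induct) (use h in \<open>auto simp: ml_hom_simps\<close>)
  qed
qed (auto simp: ml_hom_simps)

end


section \<open>The commutator ideal as a module over the polynomial algebra\<close>

definition commutator_ideal :: "('n, 'k::field) free_ml set" where
  "commutator_ideal = ml.span {ml_bracket u v | u v. True}"

text \<open>\<open>K[r\<^sub>i | i \<in> 'n]\<close>: exponent vectors are finitely supported functions \<open>'n \<Rightarrow>\<^sub>0 nat\<close>.\<close>

type_synonym ('n, 'k) rpoly = "('n \<Rightarrow>\<^sub>0 nat) \<Rightarrow>\<^sub>0 'k"

definition rvar :: "'n \<Rightarrow> ('n, 'k::field) rpoly" where
  "rvar i = Poly_Mapping.single (Poly_Mapping.single i 1) 1"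

definition rconst :: "'k::field \<Rightarrow> ('n, 'k) rpoly" where
  "rconst c = Poly_Mapping.single 0 c"

text \<open>\<open>u r\<^sub>i\<^sub>1 \<cdots> r\<^sub>i\<^sub>k = [\<dots>[u, x\<^sub>i\<^sub>1], \<dots>, x\<^sub>i\<^sub>k]\<close> for some ordering of the factors of the monomial;
  on \<open>commutator_ideal\<close> the ordering is irrelevant (\<open>mon_act_eq\<close> below), outside of it \<open>ml_act\<close> is
  not meant to be used.\<close>

definition mon_act :: "('n, 'k::field) free_ml \<Rightarrow> ('n \<Rightarrow>\<^sub>0 nat) \<Rightarrow> ('n, 'k) free_ml" where
  "mon_act u m = foldl (\<lambda>v i. ml_bracket v (ml_gen i)) u
     (SOME is. \<forall>i. count_list is i = Poly_Mapping.lookup m i)"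

definition ml_act :: "('n, 'k::field) free_ml \<Rightarrow> ('n, 'k) rpoly \<Rightarrow> ('n, 'k) free_ml" where
  "ml_act u f = (\<Sum>m\<in>Poly_Mapping.keys f. ml_scale (Poly_Mapping.lookup f m) (mon_act u m))"

lemma bracket_in_commutator_ideal [simp]: "ml_bracket u v \<in> commutator_ideal"
  unfolding commutator_ideal_def by (rule ml.span_base) auto

lemma bracket_commutator_commutator:
  assumes "u \<in> commutator_ideal"
  shows "ml_bracket u (ml_bracket x y) = 0"
  using assms unfolding commutator_ideal_def
  by (induction u rule: ml.span_induct_alt)
    (auto simp: ml.bracket_add_left ml.bracket_scale_left ml.metabelian)

lemma bracket_gen_commute:
  assumes "u \<in> commutator_ideal"
  shows "ml_bracket (ml_bracket u x) y = ml_bracket (ml_bracket u y) x"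
  using ml.leibniz[of u x y] bracket_commutator_commutator[OF assms] by simp

lemma foldl_bracket_commutator:
  assumes "u \<in> commutator_ideal"
  shows "foldl (\<lambda>v i. ml_bracket v (ml_gen i)) u is \<in> commutator_ideal"
  using assms by (induction "is" arbitrary: u) auto

lemma foldl_bracket_move:
  assumes "u \<in> commutator_ideal"
  shows "foldl (\<lambda>v i. ml_bracket v (ml_gen i)) (ml_bracket u x) is
    = ml_bracket (foldl (\<lambda>v i. ml_bracket v (ml_gen i)) u is) x"
  using assms
proof (induction "is" arbitrary: u)
  case (Cons i "is")
  then show ?case
    using Cons.IH[of "ml_bracket u (ml_gen i)"] bracket_gen_commute[of u x "ml_gen i"] by simp
qed simp

lemma foldl_bracket_cong:
  assumes "u \<in> commutator_ideal" "\<And>i. count_list is i = count_list js i"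
  shows "foldl (\<lambda>v i. ml_bracket v (ml_gen i)) u is = foldl (\<lambda>v i. ml_bracket v (ml_gen i)) u js"
  using assms
proof (induction "is" arbitrary: u js)
  case Nil
  then have "js = []"
    by (metis count_list.simps(1) count_list_0_iff list.set_intros(1) neq_Nil_conv)
  then show ?case by simp
next
  case (Cons i "is")
  have "count_list js i \<noteq> 0" using Cons.prems(2)[of i] by simp
  then obtain ps qs where js: "js = ps @ i # qs"
    by (metis count_list_0_iff split_list)
  have "\<And>k. count_list is k = count_list (ps @ qs) k"
  proof -
    fix k show "count_list is k = count_list (ps @ qs) k"
      using Cons.prems(2)[of k] js by (auto split: if_splits)
  qed
  then have "foldl (\<lambda>v i. ml_bracket v (ml_gen i)) (ml_bracket u (ml_gen i)) is
      = foldl (\<lambda>v i. ml_bracket v (ml_gen i)) (ml_bracket u (ml_gen i)) (ps @ qs)"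
    by (intro Cons.IH) auto
  then show ?case
    using Cons.prems(1) by (simp add: js foldl_bracket_move)
qed

lemma ex_count_list:
  fixes m :: "'n \<Rightarrow>\<^sub>0 nat"
  shows "\<exists>is. \<forall>i. count_list is i = Poly_Mapping.lookup m i"
proof (induction m rule: update_induct)
  case const
  show ?case by (rule exI[of _ "[]"]) simp
next
  case (update m i c)
  then obtain "is" where "\<forall>i. count_list is i = Poly_Mapping.lookup m i" by blast
  moreover have "count_list (replicate c i) j = (if i = j then c else 0)" for j
    by (induction c) auto
  ultimately have "\<forall>j. count_list (replicate c i @ is) j = Poly_Mapping.lookup (Poly_Mapping.update i c m) j"
    using update(1) by (auto simp: lookup_update in_keys_iff)
  then show ?case by blast
qed

lemma mon_act_eq:
  assumes "u \<in> commutator_ideal" "\<And>i. count_list is i = Poly_Mapping.lookup m i"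
  shows "mon_act u m = foldl (\<lambda>v i. ml_bracket v (ml_gen i)) u is"
  unfolding mon_act_def
  by (rule foldl_bracket_cong[OF assms(1)])
    (use someI_ex[OF ex_count_list, of m] assms(2) in auto)

lemma mon_act_commutator:
  "u \<in> commutator_ideal \<Longrightarrow> mon_act u m \<in> commutator_ideal"
  unfolding mon_act_def by (rule foldl_bracket_commutator)

lemma mon_act_plus:
  assumes "u \<in> commutator_ideal"
  shows "mon_act u (m + m') = mon_act (mon_act u m) m'"
proof -
  obtain "is" js where l: "\<forall>i. count_list is i = Poly_Mapping.lookup m i" "\<forall>i. count_list js i = Poly_Mapping.lookup m' i"
    using ex_count_list by metis
  then have "mon_act u (m + m') = foldl (\<lambda>v i. ml_bracket v (ml_gen i)) u (is @ js)"
    by (intro mon_act_eq assms) (auto simp: lookup_add)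
  moreover have "mon_act u m = foldl (\<lambda>v i. ml_bracket v (ml_gen i)) u is"
    using l by (intro mon_act_eq assms) auto
  moreover have "mon_act (mon_act u m) m'
      = foldl (\<lambda>v i. ml_bracket v (ml_gen i)) (mon_act u m) js"
    using l by (intro mon_act_eq mon_act_commutator assms) auto
  ultimately show ?thesis by simp
qed

lemma mon_act_linear:
  "mon_act (u + v) m = mon_act u m + mon_act v m"
  "mon_act (ml_scale c u) m = ml_scale c (mon_act u m)"
proof -
  have "foldl (\<lambda>v i. ml_bracket v (ml_gen i)) (u + v) is
      = foldl (\<lambda>v i. ml_bracket v (ml_gen i)) u is + foldl (\<lambda>v i. ml_bracket v (ml_gen i)) v is" for "is"
    by (induction "is" arbitrary: u v) (auto simp: ml.bracket_add_left)
  then show "mon_act (u + v) m = mon_act u m + mon_act v m" by (simp add: mon_act_def)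
  have "foldl (\<lambda>v i. ml_bracket v (ml_gen i)) (ml_scale c u) is
      = ml_scale c (foldl (\<lambda>v i. ml_bracket v (ml_gen i)) u is)" for "is"
    by (induction "is" arbitrary: u) (auto simp: ml.bracket_scale_left)
  then show "mon_act (ml_scale c u) m = ml_scale c (mon_act u m)" by (simp add: mon_act_def)
qed

lemma ml_act_superset:
  assumes "finite A" "Poly_Mapping.keys f \<subseteq> A"
  shows "ml_act u f = (\<Sum>m\<in>A. ml_scale (Poly_Mapping.lookup f m) (mon_act u m))"
  unfolding ml_act_def using assms
  by (intro sum.mono_neutral_left) (auto simp: in_keys_iff)

lemma ml_act_commutator [simp]:
  "u \<in> commutator_ideal \<Longrightarrow> ml_act u f \<in> commutator_ideal"
  unfolding ml_act_def commutator_ideal_def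
  by (intro ml.span_sum ml.span_scale) (use mon_act_commutator in \<open>auto simp: commutator_ideal_def\<close>)

lemma ml_act_add_left: "ml_act (u + v) f = ml_act u f + ml_act v f"
  by (simp add: ml_act_def mon_act_linear ml.scale_right_distrib sum.distrib)

lemma ml_act_scale_left: "ml_act (ml_scale c u) f = ml_scale c (ml_act u f)"
  by (simp add: ml_act_def mon_act_linear ml.scale_sum_right mult.commute)

lemma ml_act_zero_left [simp]: "ml_act 0 f = 0"
  using ml_act_scale_left[of 0 0 f] by simp

lemma ml_act_zero [simp]: "ml_act u 0 = 0"
  by (simp add: ml_act_def)

lemma ml_act_add: "ml_act u (f + g) = ml_act u f + ml_act u g"
proof -
  let ?A = "Poly_Mapping.keys f \<union> Poly_Mapping.keys g \<union> Poly_Mapping.keys (f + g)"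
  show ?thesis
    by (simp add: ml_act_superset[of ?A] lookup_add ml.scale_left_distrib sum.distrib subset_iff)
qed

lemma ml_act_single: "ml_act u (Poly_Mapping.single m c) = ml_scale c (mon_act u m)"
  by (simp add: ml_act_superset[of "{m}"])

lemma ml_act_rconst:
  assumes "u \<in> commutator_ideal"
  shows "ml_act u (rconst c) = ml_scale c u"
  using mon_act_eq[OF assms, of "[]" 0] by (simp add: rconst_def ml_act_single)

lemma ml_act_rvar:
  assumes "u \<in> commutator_ideal"
  shows "ml_act u (rvar i) = ml_bracket u (ml_gen i)"
  using mon_act_eq[OF assms, of "[i]" "Poly_Mapping.single i 1"]
  by (simp add: rvar_def ml_act_single lookup_single when_def)

lemma rpoly_induct [case_names zero add]:
  fixes f :: "('n, 'k::field) rpoly"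
  assumes "P 0" and "\<And>m c f. P f \<Longrightarrow> P (Poly_Mapping.single m c + f)"
  shows "P f"
proof (induction f rule: update_induct)
  case const
  then show ?case using assms(1) by simp
next
  case (update f m c)
  have "Poly_Mapping.update m c f = Poly_Mapping.single m c + f"
    using update(1)
    by (intro poly_mapping_eqI)
      (auto simp: lookup_update lookup_add lookup_single when_def in_keys_iff)
  then show ?case using assms(2)[OF update(3)] by simp
qed

lemma ml_act_mult:
  assumes "u \<in> commutator_ideal"
  shows "ml_act u (f * g) = ml_act (ml_act u f) g"
proof (induction f rule: rpoly_induct)
  case (add m c f)
  have "ml_act u (Poly_Mapping.single m c * g) = ml_act (ml_scale c (mon_act u m)) g"
  proof (induction g rule: rpoly_induct)
    case (add m' c' g)
    then show ?case
      by (simp add: distrib_left ml_act_add mult_single ml_act_single mon_act_plus[OF assms]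
          mon_act_linear mult.commute[of c' c])
  qed simp
  then show ?case
    using add by (simp add: distrib_right ml_act_add ml_act_add_left ml_act_single)
qed simp


section \<open>The action of the symmetric group\<close>

definition ml_perm :: "('n \<Rightarrow> 'n) \<Rightarrow> ('n, 'k::field) free_ml \<Rightarrow> ('n, 'k) free_ml" where
  "ml_perm \<sigma> = ml.ml_hom (\<lambda>i. ml_gen (\<sigma> i))"

text \<open>\<open>rpoly_subst g f\<close> is \<open>f\<close> with \<open>g i\<close> substituted for each \<open>r\<^sub>i\<close>.\<close>

definition rpoly_subst :: "('n \<Rightarrow> ('m, 'k::field) rpoly) \<Rightarrow> ('n, 'k) rpoly \<Rightarrow> ('m, 'k) rpoly" where
  "rpoly_subst g f = (\<Sum>m\<in>Poly_Mapping.keys f. rconst (Poly_Mapping.lookup f m) * (\<Prod>i\<in>Poly_Mapping.keys m. g i ^ Poly_Mapping.lookup m i))"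

definition rpoly_perm :: "('n \<Rightarrow> 'n) \<Rightarrow> ('n, 'k::field) rpoly \<Rightarrow> ('n, 'k) rpoly" where
  "rpoly_perm \<sigma> f = rpoly_subst (\<lambda>i. rvar (\<sigma> i)) f"

definition symmetric :: "('n, 'k::field) free_ml \<Rightarrow> bool" where
  "symmetric s \<longleftrightarrow> (\<forall>\<sigma>. \<sigma> permutes UNIV \<longrightarrow> ml_perm \<sigma> s = s)"

definition point_stabilizer :: "'n \<Rightarrow> ('n \<Rightarrow> 'n) set" where
  "point_stabilizer i = {\<pi>. \<pi> permutes UNIV \<and> \<pi> i = i}"

lemma ml_perm_simps:
  "ml_perm \<sigma> (ml_gen i) = ml_gen (\<sigma> i)"
  "ml_perm \<sigma> (u + v) = ml_perm \<sigma> u + ml_perm \<sigma> v"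
  "ml_perm \<sigma> (ml_scale c u) = ml_scale c (ml_perm \<sigma> u)"
  "ml_perm \<sigma> (ml_bracket u v) = ml_bracket (ml_perm \<sigma> u) (ml_perm \<sigma> v)"
  by (simp_all add: ml_perm_def ml.ml_hom_simps)

end

theory Submission
  imports Defs "HOL-Library.Product_Plus"
begin

text \<open>
  The right-hand side says, in a form adapted to the base point \<open>one\<close>, that the coefficients are
  permuted along with the generators: \<open>q (\<sigma> i) = \<sigma> (q i)\<close> for all \<open>\<sigma>\<close> and \<open>i\<close>. Indeed, for
  each \<open>i\<close>, \<open>\<sigma>\<close> can be written as \<open>(one \<sigma>(i)) \<pi> (one i)\<close> with \<open>\<pi>\<close> in the stabilizer of \<open>one\<close>.

  That this equivariance amounts to the symmetry of \<open>p = \<Sum> a\<^sub>i q\<^sub>i\<close> rests on two facts. The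
  symmetric group acts semilinearly, \<open>\<sigma> (u f) = (\<sigma> u) (\<sigma> f)\<close>, hence sends \<open>a\<^sub>i q\<^sub>i\<close> to
  \<open>a\<^bsub>\<sigma> i\<^esub> (\<sigma> q\<^sub>i)\<close> (\<open>ml_perm_ml_act\<close>); and the \<open>a\<^sub>i\<close> are linearly independent over the polynomial
  algebra, so that coefficients can be compared (\<open>square_coefficients_unique\<close>).

  Independence is seen in a concrete metabelian Leibniz algebra. On pairs of polynomials put
  \<open>[(l, f), (l', f')] = (0, f l')\<close>. Right multiplications commute here, and right
  multiplication by a bracket is zero, which makes all the identities evident. Sending \<open>x\<^sub>j\<close> to \<open>(r\<^sub>j, 1)\<close> and every
  other \<open>x\<^sub>i\<close> to \<open>(r\<^sub>i, 0)\<close> turns \<open>\<Sum> a\<^sub>i q\<^sub>i\<close> into \<open>(0, r\<^sub>j q\<^sub>j)\<close>, and \<open>r\<^sub>j\<close> is not a zero divisor.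
\<close>

section \<open>Polynomials and the permutation of their variables\<close>

lemma rconst_simps [simp]:
  "rconst 0 = 0" "rconst 1 = 1"
  "rconst (c + d) = rconst c + rconst d" "rconst (c * d) = rconst c * rconst d"
  by (simp_all add: rconst_def single_add mult_single)

text \<open>Unlike \<open>rpoly_induct\<close>, this rule builds the monomials up one variable at a time, which is how
  polynomials act on the commutator ideal.\<close>

lemma rpoly_generator_induct [case_names const add mult_var]:
  fixes f :: "('n, 'k::field) rpoly"
  assumes const: "\<And>c. P (rconst c)"
    and add: "\<And>f g. P f \<Longrightarrow> P g \<Longrightarrow> P (f + g)"
    and var: "\<And>f i. P f \<Longrightarrow> P (f * rvar i)"
  shows "P f"
proof -
  have power: "P (g * rvar i ^ n)" if "P g" for g i n
    using that by (induction n arbitrary: g) (auto simp: mult.assoc[symmetric] intro: var)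
  have rvar_power: "rvar i ^ n = Poly_Mapping.single (Poly_Mapping.single i n) (1::'k)" for i :: 'n and n
    by (induction n) (auto simp: rvar_def mult_single single_add[symmetric])
  have mon: "P (Poly_Mapping.single m c)" for m c
  proof (induction m rule: update_induct)
    case const
    then show ?case using assms(1)[of c] by (simp add: rconst_def)
  next
    case (update m i n)
    have "Poly_Mapping.update i n m = m + Poly_Mapping.single i n"
      using update(1)
      by (intro poly_mapping_eqI)
        (auto simp: lookup_update lookup_add lookup_single when_def in_keys_iff)
    then show ?case
      using power[OF update(3), of i n] by (simp add: rvar_power mult_single)
  qed
  show ?thesis
  proof (induction f rule: rpoly_induct)
    case zero
    then show ?case using const[of 0] by simp
  qed (auto intro: add mon)
qed

lemma rpoly_subst_superset:
  assumes "finite A" "Poly_Mapping.keys f \<subseteq> A"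
  shows "rpoly_subst g f = (\<Sum>m\<in>A. rconst (Poly_Mapping.lookup f m)
    * (\<Prod>i\<in>Poly_Mapping.keys m. g i ^ Poly_Mapping.lookup m i))"
  unfolding rpoly_subst_def using assms
  by (intro sum.mono_neutral_left) (auto simp: in_keys_iff)

lemma rpoly_subst_single:
  "rpoly_subst g (Poly_Mapping.single m c)
    = rconst c * (\<Prod>i\<in>Poly_Mapping.keys m. g i ^ Poly_Mapping.lookup m i)"
  by (simp add: rpoly_subst_superset[of "{m}"])

lemma rpoly_subst_zero [simp]: "rpoly_subst g 0 = 0"
  by (simp add: rpoly_subst_def)

lemma rpoly_subst_const [simp]: "rpoly_subst g (rconst c) = rconst c"
  unfolding rconst_def[of c] by (simp add: rpoly_subst_single) (simp add: rconst_def)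

lemma rpoly_subst_add: "rpoly_subst g (f + h) = rpoly_subst g f + rpoly_subst g h"
proof -
  let ?A = "Poly_Mapping.keys f \<union> Poly_Mapping.keys h \<union> Poly_Mapping.keys (f + h)"
  show ?thesis
    by (simp add: rpoly_subst_superset[of ?A] lookup_add distrib_right sum.distrib subset_iff)
qed

lemma rpoly_subst_mult_var: "rpoly_subst g (f * rvar i) = rpoly_subst g f * g i"
proof (induction f rule: rpoly_induct)
  case (add m c f)
  let ?s = "Poly_Mapping.single i (1::nat)"
  let ?A = "Poly_Mapping.keys m \<union> {i}"
  have superset: "(\<Prod>j\<in>Poly_Mapping.keys m'. g j ^ Poly_Mapping.lookup m' j)
      = (\<Prod>j\<in>?A. g j ^ Poly_Mapping.lookup m' j)" if "Poly_Mapping.keys m' \<subseteq> ?A" for m'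
    using that by (intro prod.mono_neutral_left) (auto simp: in_keys_iff)
  have "(\<Prod>j\<in>?A. g j ^ Poly_Mapping.lookup ?s j) = g i"
    by (subst superset[symmetric]) auto
  moreover have "Poly_Mapping.keys (m + ?s) \<subseteq> ?A"
    using Poly_Mapping.keys_add[of m ?s] by auto
  ultimately have "(\<Prod>j\<in>Poly_Mapping.keys (m + ?s). g j ^ Poly_Mapping.lookup (m + ?s) j)
      = (\<Prod>j\<in>Poly_Mapping.keys m. g j ^ Poly_Mapping.lookup m j) * g i"
    by (subst (1 2) superset) (auto simp: lookup_add power_add prod.distrib)
  then show ?case
    using add
    by (simp add: rpoly_subst_add distrib_right rvar_def mult_single rpoly_subst_single mult.assoc)
qed simp

lemma rpoly_perm_simps:
  "rpoly_perm \<sigma> (rconst c) = rconst c"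
  "rpoly_perm \<sigma> (f + g) = rpoly_perm \<sigma> f + rpoly_perm \<sigma> g"
  "rpoly_perm \<sigma> (f * rvar i) = rpoly_perm \<sigma> f * rvar (\<sigma> i)"
  by (simp_all add: rpoly_perm_def rpoly_subst_add rpoly_subst_mult_var)

lemma rpoly_perm_id [simp]: "rpoly_perm id f = f"
  by (induction f rule: rpoly_generator_induct) (simp_all add: rpoly_perm_simps)

lemma rpoly_perm_comp: "rpoly_perm \<sigma> (rpoly_perm \<tau> f) = rpoly_perm (\<sigma> \<circ> \<tau>) f"
  by (induction f rule: rpoly_generator_induct) (simp_all add: rpoly_perm_simps)

text \<open>Multiplication by a variable shifts the coefficients along an injection of exponent vectors.\<close>

lemma rvar_mult_cancel:
  fixes f g :: "('n, 'k::field) rpoly"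
  assumes "rvar i * f = rvar i * g"
  shows "f = g"
proof (rule poly_mapping_eqI)
  fix m
  have shift: "Poly_Mapping.lookup (rvar i * h) (Poly_Mapping.single i 1 + m) = Poly_Mapping.lookup h m"
    for h :: "('n, 'k) rpoly"
    by (induction h rule: rpoly_induct)
      (simp_all add: distrib_left rvar_def mult_single lookup_add lookup_single when_def)
  show "Poly_Mapping.lookup f m = Poly_Mapping.lookup g m"
    using shift[of f] shift[of g] assms by simp
qed


section \<open>Semilinearity of the symmetric group action\<close>

lemma ml_perm_commutator:
  assumes "u \<in> commutator_ideal"
  shows "ml_perm \<sigma> u \<in> commutator_ideal"
proof -
  have zero: "ml_perm \<sigma> 0 = 0"
    by (simp add: ml_perm_def ml.ml_hom_simps)
  have subspace: "ml.subspace commutator_ideal"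
    by (simp add: commutator_ideal_def ml.subspace_span)
  from assms[unfolded commutator_ideal_def] show ?thesis
    by (induction u rule: ml.span_induct_alt)
      (auto simp: zero ml_perm_simps
        intro!: ml.subspace_0[OF subspace] ml.subspace_add[OF subspace] ml.subspace_scale[OF subspace])
qed

lemma ml_act_mult_var:
  "u \<in> commutator_ideal \<Longrightarrow> ml_act u (f * rvar i) = ml_bracket (ml_act u f) (ml_gen i)"
  by (simp add: ml_act_mult ml_act_rvar)

lemma ml_perm_ml_act:
  assumes "u \<in> commutator_ideal"
  shows "ml_perm \<sigma> (ml_act u f) = ml_act (ml_perm \<sigma> u) (rpoly_perm \<sigma> f)"
  by (induction f rule: rpoly_generator_induct)
    (simp_all add: assms ml_perm_commutator ml_act_rconst ml_act_add ml_act_mult_var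
      ml_perm_simps rpoly_perm_simps)


section \<open>Independence of the squares of the generators\<close>

definition pair_scale ::
    "'k::field \<Rightarrow> ('n, 'k) rpoly \<times> ('n, 'k) rpoly \<Rightarrow> ('n, 'k) rpoly \<times> ('n, 'k) rpoly" where
  "pair_scale c u = (rconst c * fst u, rconst c * snd u)"

text \<open>The first component records how an element multiplies from the right, the second one is what
  gets multiplied. Brackets have first component zero, whence the metabelian identity.\<close>

definition pair_bracket ::
    "('n, 'k::field) rpoly \<times> ('n, 'k) rpoly \<Rightarrow> ('n, 'k) rpoly \<times> ('n, 'k) rpoly
      \<Rightarrow> ('n, 'k) rpoly \<times> ('n, 'k) rpoly" where
  "pair_bracket u v = (0, snd u * fst v)"

lemma pair_simps [simp]:
  "fst (pair_scale c u) = rconst c * fst u" "snd (pair_scale c u) = rconst c * snd u"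
  "fst (pair_bracket u v) = 0" "snd (pair_bracket u v) = snd u * fst v"
  by (simp_all add: pair_scale_def pair_bracket_def)

interpretation pair: metabelian_leibniz_algebra pair_scale pair_bracket
  by unfold_locales
    (simp_all add: prod_eq_iff algebra_simps)

text \<open>A homomorphism that sends each \<open>x\<^sub>i\<close> to a pair with first component \<open>r\<^sub>i\<close> is a module
  homomorphism, in its second component, on the commutator ideal.\<close>

lemma snd_pair_hom_ml_act:
  assumes "u \<in> commutator_ideal" and "\<And>i. fst (g i) = rvar i"
  shows "snd (pair.ml_hom g (ml_act u f)) = snd (pair.ml_hom g u) * f"
  by (induction f rule: rpoly_generator_induct)
    (simp_all add: assms ml_act_rconst ml_act_add ml_act_mult_var pair.ml_hom_simps
      algebra_simps)

lemma square_coefficients_unique: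
  fixes f g :: "'n::finite \<Rightarrow> ('n, 'k::field) rpoly"
  assumes "(\<Sum>i\<in>UNIV. ml_act (ml_bracket (ml_gen i) (ml_gen i)) (f i))
    = (\<Sum>i\<in>UNIV. ml_act (ml_bracket (ml_gen i) (ml_gen i)) (g i))"
  shows "f = g"
proof
  fix j
  define x where "x i = (rvar i :: ('n, 'k) rpoly, (if i = j then 1 else 0) :: ('n, 'k) rpoly)" for i
  have hom_sum: "snd (pair.ml_hom x (sum w A)) = (\<Sum>i\<in>A. snd (pair.ml_hom x (w i)))"
    for w :: "'n \<Rightarrow> ('n, 'k) free_ml" and A
    by (induction A rule: infinite_finite_induct) (simp_all add: pair.ml_hom_simps)
  have component: "snd (pair.ml_hom x (\<Sum>i\<in>UNIV. ml_act (ml_bracket (ml_gen i) (ml_gen i)) (h i)))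
      = rvar j * h j" for h
  proof -
    have "snd (pair.ml_hom x (ml_act (ml_bracket (ml_gen i) (ml_gen i)) (h i)))
        = (if i = j then rvar j * h j else 0)" for i
      by (subst snd_pair_hom_ml_act) (auto simp: pair.ml_hom_simps x_def)
    then show ?thesis by (simp add: hom_sum)
  qed
  have "rvar j * f j = rvar j * g j"
    using component[of f] component[of g] assms by simp
  then show "f j = g j" by (rule rvar_mult_cancel)
qed


section \<open>Symmetric linear combinations of squares\<close>

lemma symmetric_iff_equivariant:
  fixes q :: "'n::finite \<Rightarrow> ('n, 'k::field) rpoly"
  shows "symmetric (\<Sum>i\<in>UNIV. ml_act (ml_bracket (ml_gen i) (ml_gen i)) (q i))
    \<longleftrightarrow> (\<forall>\<sigma>. \<sigma> permutes UNIV \<longrightarrow> (\<forall>i. q (\<sigma> i) = rpoly_perm \<sigma> (q i)))"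
proof -
  let ?s = "\<lambda>f :: 'n \<Rightarrow> ('n, 'k) rpoly. \<Sum>i\<in>UNIV. ml_act (ml_bracket (ml_gen i) (ml_gen i)) (f i)"
  have "ml_perm \<sigma> (?s q) = ?s q \<longleftrightarrow> (\<forall>i. q (\<sigma> i) = rpoly_perm \<sigma> (q i))"
    if \<sigma>: "\<sigma> permutes UNIV" for \<sigma>
  proof -
    have perm_sum: "ml_perm \<sigma> (sum w A) = (\<Sum>i\<in>A. ml_perm \<sigma> (w i))"
      for w :: "'n \<Rightarrow> ('n, 'k) free_ml" and A
      by (induction A rule: infinite_finite_induct)
        (simp_all add: ml_perm_simps, simp_all add: ml_perm_def ml.ml_hom_simps)
    have inv: "inv \<sigma> (\<sigma> i) = i" "\<sigma> (inv \<sigma> i) = i" for i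
      using permutes_inverses[OF \<sigma>] by auto
    let ?q' = "\<lambda>j. rpoly_perm \<sigma> (q (inv \<sigma> j))"
    have "ml_perm \<sigma> (?s q)
        = (\<Sum>i\<in>UNIV. ml_act (ml_bracket (ml_gen (\<sigma> i)) (ml_gen (\<sigma> i))) (?q' (\<sigma> i)))"
      by (simp add: perm_sum ml_perm_ml_act ml_perm_simps inv)
    also have "\<dots> = ?s ?q'"
      using sum.permute[OF \<sigma>, of "\<lambda>j. ml_act (ml_bracket (ml_gen j) (ml_gen j)) (?q' j)"]
      by (simp add: comp_def)
    finally have image: "ml_perm \<sigma> (?s q) = ?s ?q'" .
    have "ml_perm \<sigma> (?s q) = ?s q \<longleftrightarrow> ?q' = q"
    proof
      assume "ml_perm \<sigma> (?s q) = ?s q"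
      then show "?q' = q" using image by (intro square_coefficients_unique) simp
    next
      assume "?q' = q"
      then have "?s ?q' = ?s q" by (rule arg_cong[where f = ?s])
      then show "ml_perm \<sigma> (?s q) = ?s q" using image by (rule trans[rotated])
    qed
    also have "\<dots> \<longleftrightarrow> (\<forall>i. q (\<sigma> i) = rpoly_perm \<sigma> (q i))"
    proof
      assume eq: "?q' = q"
      show "\<forall>i. q (\<sigma> i) = rpoly_perm \<sigma> (q i)"
      proof
        fix i show "q (\<sigma> i) = rpoly_perm \<sigma> (q i)"
          using fun_cong[OF eq, of "\<sigma> i"] by (simp add: inv)
      qed
    next
      assume eq: "\<forall>i. q (\<sigma> i) = rpoly_perm \<sigma> (q i)"
      show "?q' = q"
      proof
        fix j show "?q' j = q j"
          using spec[OF eq, of "inv \<sigma> j"] by (simp add: inv)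
      qed
    qed
    finally show ?thesis .
  qed
  then show ?thesis unfolding symmetric_def by blast
qed

theorem theorem2p1:
  fixes one :: "'n::finite"
    and q :: "'n \<Rightarrow> ('n, 'k::field_char_0) rpoly"
    and p :: "('n, 'k) free_ml"
  defines "a \<equiv> (\<lambda>i. ml_bracket (ml_gen i) (ml_gen i) :: ('n, 'k) free_ml)"
  assumes "p = (\<Sum>i\<in>UNIV. ml_act (a i) (q i))"
  shows "symmetric p \<longleftrightarrow>
      (\<forall>\<pi>\<in>point_stabilizer one. q one = rpoly_perm \<pi> (q one)) \<and>
      (\<forall>i. i \<noteq> one \<longrightarrow> (\<forall>\<sigma>\<in>point_stabilizer i. rpoly_perm \<sigma> (q i) = q i)) \<and>
      (\<forall>i. i \<noteq> one \<longrightarrow> q i = rpoly_perm (transpose one i) (q one))"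
    (is "_ \<longleftrightarrow> ?i \<and> ?ii \<and> ?iii")
proof -
  have symmetric: "symmetric p \<longleftrightarrow> (\<forall>\<sigma>. \<sigma> permutes UNIV \<longrightarrow> (\<forall>i. q (\<sigma> i) = rpoly_perm \<sigma> (q i)))"
    unfolding assms(2) a_def by (rule symmetric_iff_equivariant)
  have transposition: "transpose one i permutes UNIV" for i
    by (simp add: permutes_swap_id)
  show ?thesis
  proof
    assume "symmetric p"
    then have equivariant: "q (\<sigma> i) = rpoly_perm \<sigma> (q i)" if "\<sigma> permutes UNIV" for \<sigma> i
      using symmetric that by blast
    have stable: "rpoly_perm \<sigma> (q i) = q i" if "\<sigma> \<in> point_stabilizer i" for \<sigma> i
      using that equivariant[of \<sigma> i] by (simp add: point_stabilizer_def)
    have translate: "q i = rpoly_perm (transpose one i) (q one)" for i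
      using equivariant[OF transposition, of i one] by simp
    show "?i \<and> ?ii \<and> ?iii"
      by (blast intro: stable stable[symmetric] translate)
  next
    assume conditions: "?i \<and> ?ii \<and> ?iii"
    have base: "q i = rpoly_perm (transpose one i) (q one)" for i
    proof (cases "i = one")
      case True
      then show ?thesis by simp
    next
      case False
      then show ?thesis using conditions by blast
    qed
    have "q (\<sigma> i) = rpoly_perm \<sigma> (q i)" if \<sigma>: "\<sigma> permutes UNIV" for \<sigma> i
    proof -
      \<comment> \<open>The path \<open>one \<mapsto> i \<mapsto> \<sigma> i \<mapsto> one\<close> closes up, so this product fixes \<open>one\<close>.\<close>
      let ?\<pi> = "transpose one (\<sigma> i) \<circ> (\<sigma> \<circ> transpose one i)"
      have "?\<pi> \<in> point_stabilizer one"
        by (simp add: point_stabilizer_def permutes_compose \<sigma> transposition)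
      then have "q one = rpoly_perm ?\<pi> (q one)"
        using conditions by blast
      then have "q (\<sigma> i) = rpoly_perm (transpose one (\<sigma> i) \<circ> ?\<pi>) (q one)"
        unfolding rpoly_perm_comp[symmetric, of "transpose one (\<sigma> i)" ?\<pi>]
        using base[of "\<sigma> i"] by (simp only:)
      also have "transpose one (\<sigma> i) \<circ> ?\<pi> = \<sigma> \<circ> transpose one i"
        by (simp add: fun_eq_iff)
      also have "rpoly_perm (\<sigma> \<circ> transpose one i) (q one) = rpoly_perm \<sigma> (q i)"
        unfolding base[of i] by (rule rpoly_perm_comp[symmetric])
      finally show ?thesis .
    qed
    then show "symmetric p" using symmetric by blast
  qed
qed

end
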